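(* For every integer $n \geq 1$, the number of ascent sequences of length $n$ that avoid the pattern $0021$ equals $$\sum_{k=0}^{n-1}\binom{n-1}{k}C_k,$$ where $C_k=\frac{1}{k+1}\binom{2k}{k}$ is the $k$th Catalan number.
   Context: For an integer string $x_1\cdots x_n$, an ascent is a position $j$ with $x_j<x_{j+1}$; $\mathrm{asc}(x_1\cdots x_n)$ denotes the number of ascents. An ascent sequence of length $n$ is a sequence $x_1\cdots x_n$ of non-negative integers with $x_1=0$ and $x_i\le \mathrm{asc}(x_1\cdots x_{i-1})+1$ for $1<i\le n$. The reduction $\mathrm{red}(x)$ of an integer string $x$ is obtained by replacing every occurrence of the $i$th smallest distinct value of $x$ by $i-1$; a pattern is a reduced string (so patterns may have repeated letters and have minimum letter $0$). A string $x=x_1\cdots x_n$ contains a pattern $p=p_1\cdots p_k$ if there are indices $1\le i_1<\cdots<i_k\le n$ with $\mathrm{red}(x_{i_1}\cdots x_{i_k})=p$; otherwise $x$ avoids $p$. *)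

theory Defs
  imports Complex_Main
begin

definition asc :: "nat list \<Rightarrow> nat" where
  "asc x = card {j. Suc j < length x \<and> x ! j < x ! Suc j}"

(* Positions are counted from 0, so take i x is the prefix strictly before the entry x ! i. *)
definition ascent_sequence :: "nat list \<Rightarrow> bool" where
  "ascent_sequence x \<longleftrightarrow>
     x \<noteq> [] \<and> x ! 0 = 0 \<and>
     (\<forall>i. 0 < i \<and> i < length x \<longrightarrow> x ! i \<le> asc (take i x) + 1)"

(* The i-th smallest distinct value of x has exactly i - 1 distinct values of x below it. *)
definition red :: "nat list \<Rightarrow> nat list" where
  "red x = map (\<lambda>a. card {b \<in> set x. b < a}) x"

definition contains_pattern :: "nat list \<Rightarrow> nat list \<Rightarrow> bool" where
  "contains_pattern x p \<longleftrightarrow>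
     (\<exists>is. sorted_wrt (<) is \<and> set is \<subseteq> {..<length x} \<and> red (map (\<lambda>i. x ! i) is) = p)"

definition avoids :: "nat list \<Rightarrow> nat list \<Rightarrow> bool" where
  "avoids x p \<longleftrightarrow> \<not> contains_pattern x p"

definition catalan :: "nat \<Rightarrow> real" where
  "catalan k = 1 / (real k + 1) * real ((2 * k) choose k)"

end

theory Submission
  imports Defs "HOL-Library.Sublist"
begin

text \<open>
  Call \<open>b\<close> an extension of an avoider \<open>x\<close> if \<open>x @ [b]\<close> is again an avoider, and count avoiders by
  length and number of extensions. If 0 occurs once in \<open>x\<close>, deleting it and lowering all other
  letters gives an arbitrary shorter avoider with one extension less; if \<open>x\<close> ends in a second 0,
  deleting that 0 does not change the extensions. If \<open>x\<close> has two zeros, then after appending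
  \<open>c > 0\<close> the extensions are 0, the old ones that are at least \<open>c\<close>, and one new maximal letter if
  \<open>c\<close> creates an ascent. These rules imply that avoiders of length \<open>n + 1\<close> with two zeros, a
  positive last letter and \<open>s \<ge> 3\<close> extensions are as numerous as avoiders of length \<open>n\<close> with at
  least \<open>s\<close> extensions. Hence the numbers of avoiders evolve as in the generating tree in which a
  node with \<open>s\<close> extensions has one child with \<open>s\<close> extensions and children with \<open>3, \<dots>, s + 1\<close>
  extensions. Without the first kind of child this is the Catalan tree of Dyck paths by number of
  returns, and that child accounts for the binomial transform.
\<close>

subsection \<open>The pattern as a subsequence\<close>

text \<open>An embedding either uses the last letter of the longer word or avoids it. Words grow at
  the right end here, whereas the recursion of \<open>subseq\<close> peels letters off at the
  left.\<close>

lemma subseq_snoc_iff: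
  "subseq (xs @ [a]) (ys @ [b]) \<longleftrightarrow> a = b \<and> subseq xs ys \<or> subseq (xs @ [a]) ys"
proof
  assume "subseq (xs @ [a]) (ys @ [b])"
  then obtain us vs where uv: "xs @ [a] = us @ vs" "subseq us ys" "subseq vs [b]"
    by (rule subseq_appendE)
  show "a = b \<and> subseq xs ys \<or> subseq (xs @ [a]) ys"
  proof (cases vs rule: rev_cases)
    case Nil
    with uv show ?thesis by simp
  next
    case (snoc ws w)
    moreover from uv(3) have "length vs \<le> 1"
      using list_emb_length by fastforce
    ultimately have "vs = [w]" by simp
    with uv show ?thesis by (auto split: if_splits)
  qed
next
  assume "a = b \<and> subseq xs ys \<or> subseq (xs @ [a]) ys"
  then show "subseq (xs @ [a]) (ys @ [b])"
    using subseq_rev_drop_many by auto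
qed

lemma contains_pattern_iff_subseq: "contains_pattern x p \<longleftrightarrow> (\<exists>ys. subseq ys x \<and> red ys = p)"
proof
  assume "contains_pattern x p"
  then obtain "is" where s: "sorted_wrt (<) is" "set is \<subseteq> {..<length x}"
    and r: "red (map (\<lambda>i. x ! i) is) = p"
    unfolding contains_pattern_def by blast
  \<comment> \<open>A strictly increasing index list is determined by its set, so it is a
    subsequence of the list of all positions.\<close>
  have "is = filter (\<lambda>i. i \<in> set is) [0..<length x]"
    using s by (intro sorted_distinct_set_unique) (auto simp: strict_sorted_iff sorted_wrt_filter)
  then have "subseq is [0..<length x]"
    by (metis subseq_filter_left)
  then have "subseq (map (\<lambda>i. x ! i) is) (map (\<lambda>i. x ! i) [0..<length x])"
    by (rule subseq_map)
  with r show "\<exists>ys. subseq ys x \<and> red ys = p"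
    by (auto simp: map_nth)
next
  assume "\<exists>ys. subseq ys x \<and> red ys = p"
  then obtain N where N: "red (nths x N) = p"
    by (auto simp: subseq_conv_nths)
  let ?is = "nths [0..<length x] N"
  have "nths x N = map (\<lambda>i. x ! i) ?is"
    by (metis map_nth nths_map)
  moreover have "sorted_wrt (<) ?is"
    by (simp add: strict_sorted_iff sorted_nths)
  moreover have "set ?is \<subseteq> {..<length x}"
    using set_nths_subset[of "[0..<length x]" N] by auto
  ultimately show "contains_pattern x p"
    using N unfolding contains_pattern_def by metis
qed

text \<open>\<open>red\<close> replaces a letter by its rank. Ranks are monotone in the letter, and
  strictly so on letters that occur, so equal ranks force equal letters and ordered ranks force
  ordered letters.\<close>

lemma red_eq_0021_iff:
  "red ys = [0, 0, 2, 1] \<longleftrightarrow> (\<exists>a b c. ys = [a, a, c, b] \<and> a < b \<and> b < c)"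
proof
  assume red: "red ys = [0, 0, 2, 1]"
  then have "length ys = 4"
    unfolding red_def by (auto dest: arg_cong[where f = length])
  then obtain a a' c b where ys: "ys = [a, a', c, b]"
    by (auto simp: numeral_eq_Suc length_Suc_conv)
  let ?r = "\<lambda>u. card {v \<in> set ys. v < u}"
  have r: "?r a = 0" "?r a' = 0" "?r c = 2" "?r b = 1"
    using red unfolding red_def by (simp_all add: ys)
  have mono: "u < v" if "?r u < ?r v" for u v
  proof (rule ccontr)
    assume "\<not> u < v"
    then have "?r v \<le> ?r u" by (intro card_mono) auto
    with that show False by simp
  qed
  have smono: "?r u < ?r v" if "u \<in> set ys" "u < v" for u v
    using that by (intro psubset_card_mono psubsetI) auto
  have "a \<in> set ys" "a' \<in> set ys"
    by (simp_all add: ys)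
  then have "a = a'"
    using smono[of a a'] smono[of a' a] unfolding r by linarith
  moreover have "a < b" "b < c"
    using mono[of a b] mono[of b c] unfolding r by simp_all
  ultimately show "\<exists>a b c. ys = [a, a, c, b] \<and> a < b \<and> b < c"
    using ys by blast
next
  assume "\<exists>a b c. ys = [a, a, c, b] \<and> a < b \<and> b < c"
  then obtain a b c where ys: "ys = [a, a, c, b]" and "a < b" "b < c" by blast
  then have "{v \<in> set ys. v < a} = {}" "{v \<in> set ys. v < b} = {a}" "{v \<in> set ys. v < c} = {a, b}"
    by auto
  then show "red ys = [0, 0, 2, 1]"
    using ys \<open>a < b\<close> by (simp add: red_def)
qed

text \<open>A letter is blocked if appending it would complete an occurrence of 0021.\<close>

definition blocked :: "nat list \<Rightarrow> nat \<Rightarrow> bool" where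
  "blocked x b \<longleftrightarrow> (\<exists>a c. a < b \<and> b < c \<and> subseq [a, a, c] x)"

definition good :: "nat list \<Rightarrow> bool" where
  "good x \<longleftrightarrow> ascent_sequence x \<and> avoids x [0, 0, 2, 1]"

definition ext :: "nat list \<Rightarrow> nat set" where
  "ext x = {b. good (x @ [b])}"

lemma avoids_0021_iff:
  "avoids x [0, 0, 2, 1] \<longleftrightarrow> \<not> (\<exists>a b c. a < b \<and> b < c \<and> subseq [a, a, c, b] x)"
  unfolding avoids_def contains_pattern_iff_subseq red_eq_0021_iff by blast

lemma avoids_0021_snoc:
  "avoids (x @ [b]) [0, 0, 2, 1] \<longleftrightarrow> avoids x [0, 0, 2, 1] \<and> \<not> blocked x b"
  unfolding avoids_0021_iff blocked_def
  using subseq_snoc_iff[of "[_, _, _]" _ x b] by auto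

text \<open>In a new occurrence of 002 the appended letter must play the 2, so it blocks only
  letters below it that exceed some repeated letter.\<close>

lemma blocked_snoc:
  "blocked (x @ [c]) b \<longleftrightarrow> blocked x b \<or> b < c \<and> (\<exists>a<b. subseq [a, a] x)"
  unfolding blocked_def using subseq_snoc_iff[of "[_, _]" _ x c] by auto

lemma not_blocked_0 [simp]: "\<not> blocked x 0"
  by (simp add: blocked_def)

lemma blocked_imp_less:
  assumes "blocked x b"
  shows "\<exists>c\<in>set x. b < c"
  using assms unfolding blocked_def
  by (metis list.set_intros(1,2) notin_set_nthsI subseq_conv_nths)

lemma asc_snoc:
  assumes "x \<noteq> []"
  shows "asc (x @ [c]) = asc x + (if last x < c then 1 else 0)"
proof -
  let ?A = "{j. Suc j < length x \<and> x ! j < x ! Suc j}"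
  have "{j. Suc j < length (x @ [c]) \<and> (x @ [c]) ! j < (x @ [c]) ! Suc j} =
        ?A \<union> (if last x < c then {length x - 1} else {})"
    (is "?B = ?C")
  proof (rule set_eqI)
    fix j
    consider "Suc j < length x" | "j = length x - 1" | "length x < Suc j" by linarith
    then show "j \<in> ?B \<longleftrightarrow> j \<in> ?C"
      using assms by cases (auto simp: nth_append last_conv_nth)
  qed
  moreover have "finite ?A"
    by (rule finite_subset[of _ "{..<length x}"]) auto
  moreover have "length x - 1 \<notin> ?A"
    using assms by auto
  ultimately show ?thesis
    unfolding asc_def by auto
qed

lemma asc_singleton [simp]: "asc [a] = 0"
  by (simp add: asc_def)

lemma ascent_sequence_snoc:
  assumes "x \<noteq> []"
  shows "ascent_sequence (x @ [c]) \<longleftrightarrow> ascent_sequence x \<and> c \<le> asc x + 1"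
  using assms unfolding ascent_sequence_def
  by (auto simp: nth_append less_Suc_eq)

lemma good_snoc:
  assumes "x \<noteq> []"
  shows "good (x @ [b]) \<longleftrightarrow> good x \<and> b \<le> asc x + 1 \<and> \<not> blocked x b"
  using assms unfolding good_def ascent_sequence_snoc[OF assms] avoids_0021_snoc by blast

lemma good_singleton [simp]: "good [a] \<longleftrightarrow> a = 0"
proof -
  have "\<not> subseq [b, b, d, c] [a]" for b c d
    using list_emb_length by fastforce
  then show ?thesis
    unfolding good_def ascent_sequence_def avoids_0021_iff by auto
qed

lemma good_nonempty: "good x \<Longrightarrow> x \<noteq> []"
  by (auto simp: good_def ascent_sequence_def)

lemma hd_good: "good x \<Longrightarrow> hd x = 0"
  by (auto simp: good_def ascent_sequence_def hd_conv_nth)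

lemma ext_conv:
  assumes "good x"
  shows "ext x = {b. b \<le> asc x + 1 \<and> \<not> blocked x b}"
  using assms good_nonempty by (auto simp: ext_def good_snoc)

lemma finite_ext [simp]: "good x \<Longrightarrow> finite (ext x)"
  by (simp add: ext_conv)

lemma zero_in_ext: "good x \<Longrightarrow> 0 \<in> ext x"
  by (simp add: ext_conv)

lemma asc_less_length:
  assumes "x \<noteq> []"
  shows "asc x < length x"
  using assms by (induction x rule: rev_nonempty_induct) (auto simp: asc_snoc)

lemma card_ext_le:
  assumes "good x"
  shows "card (ext x) \<le> length x + 1"
proof -
  have "card (ext x) \<le> card {..asc x + 1}"
    by (intro card_mono) (auto simp: ext_conv assms)
  then show ?thesis
    using asc_less_length[OF good_nonempty[OF assms]] by simp
qed

text \<open>A letter equal to \<open>asc x + 1\<close> exceeds the last letter, which is at most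
  \<open>asc x\<close>; it therefore creates the very ascent that raises the bound.\<close>

lemma good_letter_le:
  assumes "good x"
  shows "\<forall>a\<in>set x. a \<le> asc x"
  using good_nonempty[OF assms] assms
proof (induction x rule: rev_nonempty_induct)
  case (single y)
  then show ?case by simp
next
  case (snoc y x)
  then have *: "\<forall>a\<in>set x. a \<le> asc x" "y \<le> asc x + 1"
    by (auto simp: good_snoc)
  with snoc.hyps have "last x \<le> asc x" by simp
  then have "y \<le> asc x" if "\<not> last x < y" using that by linarith
  with * snoc.hyps show ?case
    by (auto simp: asc_snoc)
qed

subsection \<open>Extensions of an avoiding sequence\<close>

lemma asc_shift:
  assumes "w \<noteq> []"
  shows "asc (0 # map Suc w) = asc w + 1"
  using assms
proof (induction w rule: rev_nonempty_induct)
  case (single y)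
  show ?case using asc_snoc[of "[0]" "Suc y"] by simp
next
  case (snoc y w)
  then show ?case
    using asc_snoc[of "0 # map Suc w" "Suc y"] by (simp add: asc_snoc last_map)
qed

text \<open>The leading 0 is the only zero, so it cannot be the repeated letter of the pattern; all
  blocking happens inside the shifted word.\<close>

lemma blocked_shift: "blocked (0 # map Suc w) (Suc b) \<longleftrightarrow> blocked w b"
proof
  assume "blocked (0 # map Suc w) (Suc b)"
  then obtain a c where ac: "a < Suc b" "Suc b < c" "subseq [a, a, c] (0 # map Suc w)"
    by (auto simp: blocked_def)
  have "a \<noteq> 0"
  proof
    assume "a = 0"
    with ac have "0 \<in> set (map Suc w)"
      by (auto dest: list_emb_set)
    then show False by simp
  qed
  with ac have "subseq [a, a, c] (map Suc w)" by simp
  from subseq_map[OF this, of "\<lambda>k. k - 1"] have "subseq [a - 1, a - 1, c - 1] w"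
    by (simp add: comp_def)
  with ac \<open>a \<noteq> 0\<close> show "blocked w b"
    unfolding blocked_def by (intro exI[of _ "a - 1"] exI[of _ "c - 1"]) auto
next
  assume "blocked w b"
  then obtain a c where "a < b" "b < c" "subseq [a, a, c] w"
    by (auto simp: blocked_def)
  moreover from subseq_map[OF this(3), of Suc] have "subseq [Suc a, Suc a, Suc c] (0 # map Suc w)"
    by simp
  ultimately show "blocked (0 # map Suc w) (Suc b)"
    unfolding blocked_def by blast
qed

text \<open>Behind the leading 0 both a letter and its bound go up by one, and blocked letters
  correspond. Hence each appended letter is admissible in both words or in neither.\<close>

lemma good_shift:
  assumes "w \<noteq> []"
  shows "good (0 # map Suc w) \<longleftrightarrow> good w"
  using assms
proof (induction w rule: rev_nonempty_induct)
  case (single y)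
  have "\<not> blocked [0] (Suc y)"
    using blocked_imp_less by fastforce
  then show ?case using good_snoc[of "[0]" "Suc y"] by simp
next
  case (snoc y w)
  then show ?case
    using good_snoc[of "0 # map Suc w" "Suc y"]
    by (simp add: good_snoc asc_shift blocked_shift)
qed

lemma ext_shift:
  assumes "good w"
  shows "ext (0 # map Suc w) = insert 0 (Suc ` ext w)"
proof (rule set_eqI)
  fix b
  have "good (0 # map Suc w)"
    using assms good_shift good_nonempty by blast
  moreover have "Suc b' \<in> ext (0 # map Suc w) \<longleftrightarrow> b' \<in> ext w" for b'
    using good_shift[of "w @ [b']"] by (simp add: ext_def)
  ultimately show "b \<in> ext (0 # map Suc w) \<longleftrightarrow> b \<in> insert 0 (Suc ` ext w)"
    using zero_in_ext by (cases b) auto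
qed

lemma card_ext_shift:
  assumes "good w"
  shows "card (ext (0 # map Suc w)) = Suc (card (ext w))"
  using assms by (simp add: ext_shift card_image card_insert_if)

lemma good_single_zeroE:
  assumes "good x" "length x \<ge> 2" "\<not> subseq [0, 0] x"
  obtains w where "x = 0 # map Suc w" "w \<noteq> []" "good w"
proof -
  obtain t where x: "x = 0 # t"
    using assms(1) hd_good good_nonempty by (metis list.collapse)
  let ?w = "map (\<lambda>k. k - 1) t"
  have "0 \<notin> set t"
    using assms(3) by (simp add: x subseq_singleton_left)
  then have "Suc (k - 1) = k" if "k \<in> set t" for k
    using that by (cases k) auto
  then have w: "map Suc ?w = t"
    by (simp add: map_idI)
  show thesis
  proof (rule that)
    show "x = 0 # map Suc ?w" unfolding w by (fact x)
    show "?w \<noteq> []" using assms(2) by (auto simp: x)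
    from good_shift[OF this] assms(1) \<open>x = 0 # map Suc ?w\<close> show "good ?w"
      by (simp only:)
  qed
qed

lemma not_subseq_00_shift: "\<not> subseq [0, 0] (0 # map Suc w)"
  by (simp add: subseq_singleton_left)

section \<open>How an appended letter changes the extensions\<close>

lemma ext_snoc_0:
  assumes "good y"
  shows "ext (y @ [0]) = ext y"
proof -
  have "good (y @ [0])" using assms zero_in_ext by (auto simp: ext_def)
  then show ?thesis
    using assms good_nonempty by (simp add: ext_conv asc_snoc blocked_snoc)
qed

text \<open>The two zeros make \<open>c\<close> block every positive letter below it, and an ascent
  raises the bound on the next letter by one.\<close>

lemma ext_snoc:
  assumes "good y" "subseq [0, 0] y" "c \<in> ext y" "0 < c"
  shows "ext (y @ [c]) = insert 0 ({b \<in> ext y. c \<le> b} \<union> (if last y < c then {asc y + 2} else {}))"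
proof -
  have y: "y \<noteq> []" and yc: "good (y @ [c])"
    using assms good_nonempty by (auto simp: ext_def)
  \<comment> \<open>This candidate exceeds all letters of \<open>y\<close>, and blocking a letter
    requires a larger one.\<close>
  have top: "\<not> blocked y (asc y + 2)"
    using blocked_imp_less good_letter_le[OF assms(1)] by fastforce
  have c: "c \<le> asc y + 1"
    using assms by (simp add: ext_conv)
  have blk: "blocked (y @ [c]) b \<longleftrightarrow> blocked y b \<or> 0 < b \<and> b < c" for b
    using assms(2) by (auto simp: blocked_snoc)
  have ext_c: "b \<in> ext (y @ [c]) \<longleftrightarrow> b \<le> asc y + (if last y < c then 2 else 1) \<and>
      \<not> (blocked y b \<or> 0 < b \<and> b < c)" for b
    using y yc by (simp add: ext_conv asc_snoc blk)
  show ?thesis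
  proof (rule set_eqI)
    fix b
    consider "b \<le> asc y + 1" | "b = asc y + 2" | "asc y + 2 < b" by linarith
    then show "b \<in> ext (y @ [c]) \<longleftrightarrow>
        b \<in> insert 0 ({b \<in> ext y. c \<le> b} \<union> (if last y < c then {asc y + 2} else {}))"
      unfolding ext_c using c top by cases (auto simp: ext_conv[OF assms(1)])
  qed
qed

text \<open>If the last letter is positive, both zeros stand before it, so it blocks every positive
  letter below it.\<close>

lemma last_le_ext:
  assumes "good y" "subseq [0, 0] y" "b \<in> ext y" "0 < b"
  shows "last y \<le> b"
proof (cases "last y = 0")
  case False
  obtain y' l where y: "y = y' @ [l]"
    using assms(1) good_nonempty by (cases y rule: rev_cases) auto
  then have l: "0 < l" using False by simp
  with assms(2) y have dup: "subseq [0, 0] y'"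
    using subseq_snoc_iff[of "[0]" 0 y' l] by simp
  then have "y' \<noteq> []" by auto
  with assms(1) y have "good y'" "l \<in> ext y'"
    by (auto simp: ext_def good_snoc)
  from ext_snoc[OF this(1) dup this(2) l] assms(3,4) show ?thesis
    using \<open>l \<in> ext y'\<close> \<open>good y'\<close> by (auto simp: y ext_conv split: if_splits)
qed simp

text \<open>The last letter was admissible when it was appended, and it blocks only letters strictly
  below itself.\<close>

lemma last_in_ext:
  assumes "good y" "length y \<ge> 2"
  shows "last y \<in> ext y"
proof -
  obtain y' l where y: "y = y' @ [l]" "y' \<noteq> []"
    using assms(2) by (cases y rule: rev_cases) fastforce+
  with assms have "good y'" "l \<le> asc y' + 1" "\<not> blocked y' l"
    by (auto simp: good_snoc)
  then have "\<not> blocked y l" "l \<le> asc y + 1"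
    using y by (auto simp: blocked_snoc asc_snoc)
  then show ?thesis using assms(1) y(1) by (simp add: ext_conv)
qed

lemma ext_snoc_last:
  assumes "good y" "subseq [0, 0] y" "last y \<noteq> 0"
  shows "ext (y @ [last y]) = ext y"
proof -
  have "length y \<ge> 2" using assms(2) list_emb_length by fastforce
  then have "last y \<in> ext y" using assms last_in_ext by blast
  then have "ext (y @ [last y]) = insert 0 {b \<in> ext y. last y \<le> b}"
    using assms by (simp add: ext_snoc)
  also have "\<dots> = ext y"
    using last_le_ext[OF assms(1,2)] zero_in_ext[OF assms(1)] by auto
  finally show ?thesis .
qed

text \<open>The summand 2 accounts for the letter 0 and the new largest letter
  \<open>asc y + 2\<close>.\<close>

lemma card_ext_snoc:
  assumes "good y" "subseq [0, 0] y" "c \<in> ext y" "last y < c"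
  shows "card (ext (y @ [c])) = card {b \<in> ext y. c \<le> b} + 2"
proof -
  have "asc y + 2 \<notin> ext y" using assms(1) by (simp add: ext_conv)
  then show ?thesis
    using assms by (simp add: ext_snoc card_insert_if)
qed

text \<open>The extensions not above the last letter are 0 and the last letter itself, which
  coincide when \<open>last y = 0\<close>.\<close>

lemma card_ext_greater_last:
  assumes "good y" "subseq [0, 0] y"
  shows "card {b \<in> ext y. last y < b} + (if last y = 0 then 1 else 2) = card (ext y)"
proof -
  have "length y \<ge> 2" using assms(2) list_emb_length by fastforce
  then have "last y \<in> ext y" using assms last_in_ext by blast
  then have "ext y = {b \<in> ext y. last y < b} \<union> {0, last y}"
    using last_le_ext[OF assms] zero_in_ext[OF assms(1)] by force
  then have "card (ext y) = card ({b \<in> ext y. last y < b} \<union> {0, last y})"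
    by (rule arg_cong)
  moreover have "card ({b \<in> ext y. last y < b} \<union> {0, last y}) =
      card {b \<in> ext y. last y < b} + card {0, last y}"
    using assms(1) by (intro card_Un_disjoint) auto
  ultimately show ?thesis by (simp split: if_splits)
qed

text \<open>This ranks the elements from the top. It serves to find, for each rank, the unique
  extension with that many extensions at or above it.\<close>

lemma bij_betw_card_upper:
  fixes E :: "'a :: linorder set"
  assumes "finite E"
  shows "bij_betw (\<lambda>c. card {b \<in> E. c \<le> b}) E {1..card E}"
proof -
  let ?f = "\<lambda>c. card {b \<in> E. c \<le> b}"
  have less: "?f d < ?f c" if "c \<in> E" "d \<in> E" "c < d" for c d
  proof (intro psubset_card_mono psubsetI)
    show "{b \<in> E. d \<le> b} \<noteq> {b \<in> E. c \<le> b}"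
      using that by force
  qed (use that assms in auto)
  have inj: "inj_on ?f E"
  proof (rule inj_onI)
    fix c d
    assume "c \<in> E" "d \<in> E" "?f c = ?f d"
    then show "c = d"
      using less[of c d] less[of d c] by (cases c d rule: linorder_cases) simp_all
  qed
  have "?f c \<in> {1..card E}" if "c \<in> E" for c
  proof -
    have "{b \<in> E. c \<le> b} \<noteq> {}" using that by auto
    then have "0 < ?f c" using assms by (simp add: card_gt_0_iff)
    moreover have "?f c \<le> card E" using assms by (intro card_mono) auto
    ultimately show ?thesis by simp
  qed
  then have "?f ` E \<subseteq> {1..card E}" by blast
  then have "?f ` E = {1..card E}"
    by (intro card_subset_eq) (simp_all add: card_image inj)
  with inj show ?thesis by (simp add: bij_betw_def)
qed

subsection \<open>Counting by the number of extensions\<close>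

definition avoiders :: "nat \<Rightarrow> nat list set" where
  "avoiders n = {x. good x \<and> length x = n}"

text \<open>Asking for two zeros excludes the one-letter word \<open>[0]\<close>; a longer avoider
  ending in 0 has them, as it also starts with 0.\<close>

definition avoiders_0 :: "nat \<Rightarrow> nat list set" where
  "avoiders_0 n = {x \<in> avoiders n. subseq [0, 0] x \<and> last x = 0}"

definition avoiders_pos :: "nat \<Rightarrow> nat list set" where
  "avoiders_pos n = {x \<in> avoiders n. subseq [0, 0] x \<and> last x \<noteq> 0}"

definition num_ext_eq :: "nat list set \<Rightarrow> nat \<Rightarrow> nat" where
  "num_ext_eq A s = card {x \<in> A. card (ext x) = s}"

definition num_ext_ge :: "nat list set \<Rightarrow> nat \<Rightarrow> nat" where
  "num_ext_ge A s = card {x \<in> A. s \<le> card (ext x)}"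

lemma finite_avoiders [simp]: "finite (avoiders n)"
proof (rule finite_subset)
  show "avoiders n \<subseteq> {x. set x \<subseteq> {..n} \<and> length x = n}"
  proof
    fix x assume "x \<in> avoiders n"
    then have x: "good x" "length x = n" by (auto simp: avoiders_def)
    then have "asc x < n" using asc_less_length good_nonempty by blast
    with good_letter_le[OF x(1)] x(2) show "x \<in> {x. set x \<subseteq> {..n} \<and> length x = n}"
      by fastforce
  qed
qed (simp add: finite_lists_length_eq)

lemma finite_avoiders_0 [simp]: "finite (avoiders_0 n)"
  and finite_avoiders_pos [simp]: "finite (avoiders_pos n)"
  by (simp_all add: avoiders_0_def avoiders_pos_def)

lemma num_ext_ge_rec:
  assumes "finite A"
  shows "num_ext_ge A s = num_ext_eq A s + num_ext_ge A (Suc s)"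
proof -
  have "{x \<in> A. s \<le> card (ext x)} = {x \<in> A. card (ext x) = s} \<union> {x \<in> A. Suc s \<le> card (ext x)}"
    by auto
  then show ?thesis
    unfolding num_ext_ge_def num_ext_eq_def using assms
    by (simp add: card_Un_disjoint disjoint_iff)
qed

text \<open>An avoider of length \<open>n\<close> has at most \<open>n + 1\<close> extensions. This
  is the starting point for the downward inductions on the number of extensions.\<close>

lemma num_ext_ge_eq_0:
  assumes "A \<subseteq> avoiders n" "n + 1 < s"
  shows "num_ext_ge A s = 0"
proof -
  have "{x \<in> A. s \<le> card (ext x)} = {}"
    using assms card_ext_le by (fastforce simp: avoiders_def)
  then show ?thesis by (simp only: num_ext_ge_def card.empty)
qed

lemma num_ext_eq_0: "num_ext_eq (avoiders n) 0 = 0"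
proof -
  have "card (ext x) > 0" if "good x" for x
    using zero_in_ext[OF that] that by (auto simp: card_gt_0_iff)
  then have "{x \<in> avoiders n. card (ext x) = 0} = {}"
    by (fastforce simp: avoiders_def)
  then show ?thesis by (simp only: num_ext_eq_def card.empty)
qed

section \<open>Recurrences for the three classes of avoiders\<close>

lemma avoiders_0_Suc:
  assumes "n \<ge> 1"
  shows "avoiders_0 (Suc n) = (\<lambda>y. y @ [0]) ` avoiders n"
proof (intro equalityI subsetI)
  fix x assume x: "x \<in> avoiders_0 (Suc n)"
  then have "good x" "length x = Suc n" "last x = 0"
    by (auto simp: avoiders_0_def avoiders_def)
  then obtain y where y: "x = y @ [0]"
    by (metis append_butlast_last_id good_nonempty)
  with \<open>length x = Suc n\<close> assms have "y \<noteq> []" "length y = n" by auto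
  with y \<open>good x\<close> have "y \<in> avoiders n"
    by (auto simp: avoiders_def good_snoc)
  with y show "x \<in> (\<lambda>y. y @ [0]) ` avoiders n" by blast
next
  fix x assume "x \<in> (\<lambda>y. y @ [0]) ` avoiders n"
  then obtain y where y: "x = y @ [0]" "good y" "length y = n"
    by (auto simp: avoiders_def)
  have "0 \<in> set y"
    using y(2) hd_good good_nonempty by (metis hd_in_set)
  then have "subseq [0, 0] x"
    using subseq_snoc_iff[of "[0]" 0 y 0] y(1) by (simp add: subseq_singleton_left)
  moreover have "good x"
    using zero_in_ext[OF y(2)] y(1) by (simp add: ext_def)
  ultimately show "x \<in> avoiders_0 (Suc n)"
    using y by (simp add: avoiders_0_def avoiders_def)
qed

text \<open>Deleting the final 0 is a bijection that keeps the extensions. The predicate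
  \<open>P\<close> covers exact counts and tail counts at once.\<close>

lemma card_avoiders_0_Suc:
  assumes "n \<ge> 1"
  shows "card {x \<in> avoiders_0 (Suc n). P (card (ext x))} = card {y \<in> avoiders n. P (card (ext y))}"
proof -
  have "{x \<in> avoiders_0 (Suc n). P (card (ext x))} =
      (\<lambda>y. y @ [0]) ` {y \<in> avoiders n. P (card (ext y))}"
    unfolding avoiders_0_Suc[OF assms] by (auto simp: avoiders_def ext_snoc_0)
  then show ?thesis by (simp add: card_image inj_on_def)
qed

lemma card_avoiders_single_zero:
  assumes "n \<ge> 1"
  shows "card {x \<in> avoiders (Suc n). \<not> subseq [0, 0] x \<and> card (ext x) = Suc s} =
    num_ext_eq (avoiders n) s"
proof -
  have "{x \<in> avoiders (Suc n). \<not> subseq [0, 0] x \<and> card (ext x) = Suc s} =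
      (\<lambda>w. 0 # map Suc w) ` {w \<in> avoiders n. card (ext w) = s}"
  proof (intro equalityI subsetI)
    fix x assume "x \<in> {x \<in> avoiders (Suc n). \<not> subseq [0, 0] x \<and> card (ext x) = Suc s}"
    then have x: "good x" "length x = Suc n" "\<not> subseq [0, 0] x" "card (ext x) = Suc s"
      by (auto simp: avoiders_def)
    with assms obtain w where "x = 0 # map Suc w" "good w"
      using good_single_zeroE[of x] by auto
    with x show "x \<in> (\<lambda>w. 0 # map Suc w) ` {w \<in> avoiders n. card (ext w) = s}"
      by (auto simp: avoiders_def card_ext_shift)
  next
    fix x assume "x \<in> (\<lambda>w. 0 # map Suc w) ` {w \<in> avoiders n. card (ext w) = s}"
    then obtain w where w: "x = 0 # map Suc w" "good w" "length w = n" "card (ext w) = s"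
      by (auto simp: avoiders_def)
    then show "x \<in> {x \<in> avoiders (Suc n). \<not> subseq [0, 0] x \<and> card (ext x) = Suc s}"
      using good_shift[OF good_nonempty] card_ext_shift not_subseq_00_shift
      by (simp add: avoiders_def)
  qed
  moreover have "inj_on (\<lambda>w. 0 # map Suc w) A" for A
    by (intro inj_onI) (simp add: inj_map_eq_map)
  ultimately show ?thesis
    by (simp add: card_image num_ext_eq_def)
qed

text \<open>The summands count the words with a single zero, those ending in a further 0, and those
  with two zeros and a positive last letter.\<close>

lemma num_ext_eq_avoiders_Suc:
  assumes "n \<ge> 1"
  shows "num_ext_eq (avoiders (Suc n)) (Suc s) =
    num_ext_eq (avoiders n) s + num_ext_eq (avoiders n) (Suc s) +
    num_ext_eq (avoiders_pos (Suc n)) (Suc s)"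
proof -
  let ?A = "{x \<in> avoiders (Suc n). \<not> subseq [0, 0] x \<and> card (ext x) = Suc s}"
  let ?B = "{x \<in> avoiders_0 (Suc n). card (ext x) = Suc s}"
  let ?C = "{x \<in> avoiders_pos (Suc n). card (ext x) = Suc s}"
  have "{x \<in> avoiders (Suc n). card (ext x) = Suc s} = ?A \<union> ?B \<union> ?C"
    by (auto simp: avoiders_0_def avoiders_pos_def)
  moreover have "card (?A \<union> ?B \<union> ?C) = card ?A + card ?B + card ?C"
    by (subst card_Un_disjoint; (auto simp: avoiders_0_def avoiders_pos_def)?)+
  ultimately show ?thesis
    using card_avoiders_single_zero[OF assms, of s]
      card_avoiders_0_Suc[OF assms, of "\<lambda>k. k = Suc s"]
    by (simp add: num_ext_eq_def)
qed

lemma avoiders_pos_snocE: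
  assumes "x \<in> avoiders_pos (Suc n)"
  obtains y c where "x = y @ [c]" "good y" "length y = n" "subseq [0, 0] y" "0 < c"
    "c \<in> ext y" "last y \<le> c"
proof -
  have x: "good x" "length x = Suc n" "subseq [0, 0] x" "last x \<noteq> 0"
    using assms by (auto simp: avoiders_pos_def avoiders_def)
  then obtain y c where y: "x = y @ [c]"
    by (metis append_butlast_last_id good_nonempty)
  with x have c: "0 < c" by simp
  with x y have dup: "subseq [0, 0] y"
    using subseq_snoc_iff[of "[0]" 0 y c] by simp
  then have "y \<noteq> []" by auto
  with x y have "good y" "c \<in> ext y"
    by (auto simp: ext_def good_snoc)
  with last_le_ext[OF _ dup] c x y dup that show thesis
    by simp
qed

lemma avoiders_pos_snocI:
  assumes "length y = n" "subseq [0, 0] y" "0 < c" "c \<in> ext y"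
  shows "y @ [c] \<in> avoiders_pos (Suc n)"
  using assms subseq_rev_drop_many by (auto simp: avoiders_pos_def avoiders_def ext_def)

text \<open>Repeating a positive last letter behind two zeros keeps the extensions, and deleting the
  repetition inverts this.\<close>

lemma card_avoiders_pos_repeat:
  "card {x \<in> avoiders_pos (Suc n). card (ext x) = s \<and> last (butlast x) = last x} =
    num_ext_eq (avoiders_pos n) s"
proof -
  have "{x \<in> avoiders_pos (Suc n). card (ext x) = s \<and> last (butlast x) = last x} =
      (\<lambda>y. y @ [last y]) ` {y \<in> avoiders_pos n. card (ext y) = s}"
  proof (intro equalityI subsetI)
    fix x assume x: "x \<in> {x \<in> avoiders_pos (Suc n). card (ext x) = s \<and> last (butlast x) = last x}"
    then obtain y c where yc: "x = y @ [c]" "good y" "length y = n" "subseq [0, 0] y" "0 < c"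
      using avoiders_pos_snocE by blast
    with x have "c = last y" by simp
    with x yc show "x \<in> (\<lambda>y. y @ [last y]) ` {y \<in> avoiders_pos n. card (ext y) = s}"
      using ext_snoc_last[of y] by (auto simp: avoiders_pos_def avoiders_def)
  next
    fix x assume "x \<in> (\<lambda>y. y @ [last y]) ` {y \<in> avoiders_pos n. card (ext y) = s}"
    then obtain y where y: "x = y @ [last y]" "good y" "length y = n" "subseq [0, 0] y"
      "last y \<noteq> 0" "card (ext y) = s"
      by (auto simp: avoiders_pos_def avoiders_def)
    have "length y \<ge> 2" using y(4) list_emb_length by fastforce
    with y have "x \<in> avoiders_pos (Suc n)"
      using avoiders_pos_snocI[of y n "last y"] last_in_ext by simp
    moreover have "card (ext x) = s"
      using ext_snoc_last[OF y(2,4,5)] y(1,6) by metis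
    moreover have "last (butlast x) = last x"
      by (subst (1 2) y(1)) simp
    ultimately show "x \<in> {x \<in> avoiders_pos (Suc n). card (ext x) = s \<and> last (butlast x) = last x}"
      by blast
  qed
  moreover have "inj_on (\<lambda>y. y @ [last y]) A" for A :: "nat list set"
    by (intro inj_onI) simp
  ultimately show ?thesis
    by (simp add: card_image num_ext_eq_def)
qed

text \<open>Appending the \<open>j\<close>th largest extension \<open>c\<close> of \<open>y\<close> with \<open>c > last y\<close> gives a word with exactly
  \<open>j + 2\<close> extensions, so \<open>y\<close> has at most one such child of each size.\<close>

lemma card_avoiders_pos_ascent:
  "card {x \<in> avoiders_pos (Suc n). card (ext x) = s + 3 \<and> last (butlast x) < last x} =
    num_ext_ge (avoiders_0 n) (s + 2) + num_ext_ge (avoiders_pos n) (s + 3)"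
proof -
  let ?X = "{x \<in> avoiders_pos (Suc n). card (ext x) = s + 3 \<and> last (butlast x) < last x}"
  let ?up = "\<lambda>y. {b \<in> ext y. last y < b}"
  let ?Y = "{y \<in> avoiders n. subseq [0, 0] y \<and> s + 1 \<le> card (?up y)}"
  have card_up: "card (ext (y @ [c])) = card {b \<in> ?up y. c \<le> b} + 2"
    if "good y" "subseq [0, 0] y" "c \<in> ?up y" for y c
  proof -
    have "{b \<in> ext y. c \<le> b} = {b \<in> ?up y. c \<le> b}" using that(3) by auto
    with that show ?thesis using card_ext_snoc[of y c] by simp
  qed
  have fin: "finite (?up y)" if "good y" for y
    using that by simp
  have "bij_betw butlast ?X ?Y"
    unfolding bij_betw_def
  proof (intro conjI inj_onI equalityI subsetI)
    fix x x' assume x: "x \<in> ?X" and x': "x' \<in> ?X" and eq: "butlast x = butlast x'"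
    obtain y c where yc: "x = y @ [c]" "good y" "subseq [0, 0] y" "c \<in> ext y"
      using x avoiders_pos_snocE by blast
    obtain c' where c': "x' = y @ [c']" "c' \<in> ext y"
      using x' eq yc(1) avoiders_pos_snocE[of x' n] by (metis (no_types, lifting) butlast_snoc mem_Collect_eq)
    have "c \<in> ?up y" "c' \<in> ?up y"
      using x x' yc c' by auto
    moreover from this have "card {b \<in> ?up y. c \<le> b} = card {b \<in> ?up y. c' \<le> b}"
      using card_up[OF yc(2,3), of c] card_up[OF yc(2,3), of c'] x x' yc(1) c'(1) by simp
    ultimately have "c = c'"
      using bij_betw_imp_inj_on[OF bij_betw_card_upper[OF fin[OF yc(2)]]] by (meson inj_onD)
    with yc c' show "x = x'" by simp
  next
    fix y assume "y \<in> butlast ` ?X"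
    then obtain x where x: "x \<in> ?X" "y = butlast x" by blast
    obtain y' c where yc: "x = y' @ [c]" "good y'" "length y' = n" "subseq [0, 0] y'" "c \<in> ext y'"
      using x avoiders_pos_snocE by blast
    from x(2) have "y' = y" unfolding yc(1) by simp
    note yc = yc[unfolded this]
    have c: "c \<in> ?up y" using x(1) yc(1,5) by simp
    have "s + 1 = card {b \<in> ?up y. c \<le> b}"
      using card_up[OF yc(2,4) c] x(1) yc(1) by simp
    also have "\<dots> \<le> card (?up y)"
      using fin[OF yc(2)] by (intro card_mono) auto
    finally show "y \<in> ?Y"
      using yc(2-4) by (simp add: avoiders_def)
  next
    fix y assume "y \<in> ?Y"
    then have y: "good y" "length y = n" "subseq [0, 0] y" "s + 1 \<le> card (?up y)"
      by (auto simp: avoiders_def)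
    then have "s + 1 \<in> (\<lambda>c. card {b \<in> ?up y. c \<le> b}) ` ?up y"
      unfolding bij_betw_imp_surj_on[OF bij_betw_card_upper[OF fin[OF y(1)]]] by simp
    then obtain c where c: "c \<in> ?up y" "card {b \<in> ?up y. c \<le> b} = s + 1"
      by (metis (no_types, lifting) imageE)
    then have "y @ [c] \<in> ?X"
      using avoiders_pos_snocI[of y n c] card_up[OF y(1,3) c(1)] y by simp
    then show "y \<in> butlast ` ?X"
      by (metis (no_types, lifting) butlast_snoc imageI)
  qed
  then have "card ?X = card ?Y"
    by (rule bij_betw_same_card)
  \<comment> \<open>At least \<open>s + 1\<close> extensions above the last letter means at least
    \<open>s + 2\<close> in all if that letter is 0, and at least \<open>s + 3\<close>
    otherwise.\<close>
  also have "?Y = {y \<in> avoiders_0 n. s + 2 \<le> card (ext y)} \<union> {y \<in> avoiders_pos n. s + 3 \<le> card (ext y)}"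
  proof (rule set_eqI)
    fix y
    show "y \<in> ?Y \<longleftrightarrow>
      y \<in> {y \<in> avoiders_0 n. s + 2 \<le> card (ext y)} \<union> {y \<in> avoiders_pos n. s + 3 \<le> card (ext y)}"
    proof (cases "y \<in> avoiders n \<and> subseq [0, 0] y")
      case True
      with card_ext_greater_last[of y] show ?thesis
        by (auto simp: avoiders_def avoiders_0_def avoiders_pos_def split: if_splits)
    qed (auto simp: avoiders_0_def avoiders_pos_def)
  qed
  also have "card \<dots> = num_ext_ge (avoiders_0 n) (s + 2) + num_ext_ge (avoiders_pos n) (s + 3)"
    unfolding num_ext_ge_def
    by (intro card_Un_disjoint) (auto simp: avoiders_0_def avoiders_pos_def)
  finally show ?thesis .
qed

lemma num_ext_eq_avoiders_pos_Suc:
  "num_ext_eq (avoiders_pos (Suc n)) s = num_ext_eq (avoiders_pos n) s +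
    (if s \<ge> 3 then num_ext_ge (avoiders_0 n) (s - 1) + num_ext_ge (avoiders_pos n) s else 0)"
proof -
  let ?X = "{x \<in> avoiders_pos (Suc n). card (ext x) = s \<and> last (butlast x) < last x}"
  let ?R = "{x \<in> avoiders_pos (Suc n). card (ext x) = s \<and> last (butlast x) = last x}"
  have "last (butlast x) \<le> last x" if "x \<in> avoiders_pos (Suc n)" for x
    using that by (elim avoiders_pos_snocE) simp
  then have "{x \<in> avoiders_pos (Suc n). card (ext x) = s} = ?R \<union> ?X"
    by (auto simp: le_less)
  moreover have "card (?R \<union> ?X) = card ?R + card ?X"
    by (intro card_Un_disjoint) auto
  ultimately have sum: "num_ext_eq (avoiders_pos (Suc n)) s = num_ext_eq (avoiders_pos n) s + card ?X"
    by (simp add: num_ext_eq_def card_avoiders_pos_repeat)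
  show ?thesis
  proof (cases "s \<ge> 3")
    case True
    then obtain s' where "s = s' + 3" by (metis le_add_diff_inverse2)
    with sum show ?thesis using card_avoiders_pos_ascent[of n s'] by simp
  next
    case False
    \<comment> \<open>After an ascent to \<open>c\<close>, the letters 0, \<open>c\<close> and the
      new largest letter are three different extensions.\<close>
    have "s \<ge> 3" if x: "x \<in> ?X" for x
    proof -
      obtain y c where yc: "x = y @ [c]" "good y" "subseq [0, 0] y" "c \<in> ext y"
        using x avoiders_pos_snocE by blast
      with x have "last y < c" by simp
      have "{b \<in> ext y. c \<le> b} \<noteq> {}" "finite {b \<in> ext y. c \<le> b}" using yc by auto
      then have "card {b \<in> ext y. c \<le> b} > 0" by (simp add: card_gt_0_iff)
      with card_ext_snoc[OF yc(2-4) \<open>last y < c\<close>] x yc(1) show ?thesis by simp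
    qed
    with False have "?X = {}" by blast
    with sum False show ?thesis by (simp only: card.empty) simp
  qed
qed

lemma not_subseq_00_length_1: "length x = 1 \<Longrightarrow> \<not> subseq [0, 0] x"
  using list_emb_length by fastforce

text \<open>Both sides have the same difference between \<open>s\<close> and \<open>s + 1\<close>, namely the number of avoiders of
  length \<open>n + 2\<close> with exactly \<open>s\<close> extensions, and both vanish for large \<open>s\<close>.\<close>

lemma num_ext_eq_avoiders_pos_Suc_Suc:
  "num_ext_eq (avoiders_pos (Suc (Suc n))) s =
    (if s \<ge> 3 then num_ext_ge (avoiders (Suc n)) s else 0)"
proof (induction n arbitrary: s)
  case 0
  have "avoiders_pos 1 = {}" "avoiders_0 1 = {}"
    using not_subseq_00_length_1 by (auto simp: avoiders_pos_def avoiders_0_def avoiders_def)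
  then have "num_ext_eq (avoiders_pos (Suc (Suc 0))) s = 0"
    by (subst num_ext_eq_avoiders_pos_Suc) (simp add: num_ext_eq_def num_ext_ge_def)
  moreover have "num_ext_ge (avoiders 1) s = 0" if "s \<ge> 3"
    using that by (intro num_ext_ge_eq_0) auto
  ultimately show ?case by simp
next
  case (Suc n)
  let ?D = "\<lambda>s. num_ext_eq (avoiders_pos (Suc (Suc (Suc n)))) s"
  let ?E = "\<lambda>s. num_ext_ge (avoiders (Suc (Suc n))) s"
  have ge_0: "num_ext_ge (avoiders_0 (Suc (Suc n))) t = num_ext_ge (avoiders (Suc n)) t" for t
    unfolding num_ext_ge_def by (rule card_avoiders_0_Suc) simp
  \<comment> \<open>Subtracting the recurrence for \<open>Suc s\<close> from that for
    \<open>s\<close> turns tail counts into exact counts; the three differences are the three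
    classes of avoiders with exactly \<open>s\<close> extensions.\<close>
  have rec: "?D s = ?D (Suc s) + num_ext_eq (avoiders (Suc (Suc n))) s" if s: "s \<ge> 3" for s
  proof -
    obtain t where t: "s = Suc t" "t \<ge> 2"
      using s by (cases s) auto
    then show ?thesis
      using num_ext_eq_avoiders_pos_Suc[of "Suc (Suc n)" s]
        num_ext_eq_avoiders_pos_Suc[of "Suc (Suc n)" "Suc s"]
        num_ext_ge_rec[of "avoiders (Suc n)" t] num_ext_ge_rec[of "avoiders (Suc n)" s]
        num_ext_ge_rec[of "avoiders_pos (Suc (Suc n))" s]
        num_ext_eq_avoiders_Suc[of "Suc n" t]
        Suc.IH[of s] Suc.IH[of "Suc s"]
      by (simp add: ge_0)
  qed
  have large: "?D s = ?E s" if "s \<ge> n + 5" for s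
  proof -
    have "num_ext_ge (avoiders_pos (Suc (Suc (Suc n)))) s = 0"
      using that by (intro num_ext_ge_eq_0[of _ "Suc (Suc (Suc n))"]) (auto simp: avoiders_pos_def)
    then have "?D s = 0"
      using num_ext_ge_rec[of "avoiders_pos (Suc (Suc (Suc n)))" s] by simp
    moreover have "?E s = 0"
      using that by (intro num_ext_ge_eq_0) auto
    ultimately show ?thesis by simp
  qed
  have "?D s = ?E s" if "s \<ge> 3" for s
  proof (cases "s \<le> n + 5")
    case True
    then show ?thesis using \<open>s \<ge> 3\<close>
    proof (induction s rule: inc_induct)
      case base
      show ?case by (rule large) simp
    next
      case (step t)
      then show ?case
        using rec[of t] num_ext_ge_rec[of "avoiders (Suc (Suc n))" t] by simp
    qed
  qed (use large in simp)
  then show ?case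
    using num_ext_eq_avoiders_pos_Suc[of "Suc (Suc n)" s] Suc.IH[of s] by (cases "s \<ge> 3") simp_all
qed

section \<open>At least two extensions for every avoider\<close>

lemma avoiders_1: "avoiders (Suc 0) = {[0]}"
  by (auto simp: avoiders_def length_Suc_conv)

lemma card_ext_singleton: "card (ext [0]) = 2"
proof -
  have "\<not> blocked [0] b" for b
    using blocked_imp_less by fastforce
  then have "ext [0] = {0, 1}"
    by (auto simp: ext_conv)
  then show ?thesis by simp
qed

text \<open>Deleting a zero would leave a shorter avoider with no extension or with one, and words
  with two zeros and a positive last letter have at least three.\<close>

lemma num_ext_eq_avoiders_1: "num_ext_eq (avoiders (Suc n)) 1 = 0"
proof (induction n)
  case 0
  have "{x \<in> avoiders (Suc 0). card (ext x) = 1} = {}"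
    by (auto simp: avoiders_1 card_ext_singleton)
  then show ?case by (simp only: num_ext_eq_def card.empty)
next
  case (Suc n)
  then show ?case
    using num_ext_eq_avoiders_Suc[of "Suc n" 0] num_ext_eq_avoiders_pos_Suc_Suc[of n 1]
    by (simp add: num_ext_eq_0)
qed

lemma card_avoiders: "card (avoiders (Suc n)) = num_ext_ge (avoiders (Suc n)) 2"
proof -
  have "card (avoiders (Suc n)) = num_ext_ge (avoiders (Suc n)) 0"
    by (simp add: num_ext_ge_def)
  then show ?thesis
    using num_ext_ge_rec[of "avoiders (Suc n)" 0] num_ext_ge_rec[of "avoiders (Suc n)" 1]
    by (simp add: num_ext_eq_0 num_ext_eq_avoiders_1[unfolded One_nat_def] numeral_2_eq_2)
qed

subsection \<open>Ballot numbers\<close>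

text \<open>The value \<open>ballot i k\<close> counts the Dyck paths of semilength \<open>i\<close> with at least \<open>k\<close> returns.
  The guard rules out the truncation of \<open>2 * i - k\<close>.\<close>

definition ballot :: "nat \<Rightarrow> nat \<Rightarrow> real" where
  "ballot i k = (if k \<le> i then real ((2 * i - k) choose i) - real ((2 * i - k) choose Suc i) else 0)"

lemma ballot_0_0: "ballot 0 0 = 1"
  and ballot_eq_0: "i < k \<Longrightarrow> ballot i k = 0"
  by (simp_all add: ballot_def)

text \<open>This is Pascal's rule applied to both binomials. It says that paths with exactly
  \<open>k + 1\<close> returns match paths of semilength one less with at least \<open>k\<close>
  returns.\<close>

lemma ballot_Suc_Suc: "ballot (Suc i) (Suc k) = ballot (Suc i) (Suc (Suc k)) + ballot i k"
proof -
  consider "k < i" | "k = i" | "i < k" by linarith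
  then show ?thesis
  proof cases
    case 1
    define m where "m = 2 * i - k"
    have "2 * Suc i - Suc k = Suc m" "2 * Suc i - Suc (Suc k) = m"
      using 1 by (auto simp: m_def)
    with 1 show ?thesis by (simp add: ballot_def m_def[symmetric])
  qed (auto simp: ballot_def)
qed

text \<open>Every nonempty Dyck path has a return; in the formula this is the symmetry of row
  \<open>2 * i + 1\<close> of Pascal's triangle.\<close>

lemma ballot_Suc_0: "ballot (Suc i) 0 = ballot (Suc i) (Suc 0)"
proof -
  have "Suc (2 * i) choose i = Suc (2 * i) choose Suc i"
    using binomial_symmetric[of i "Suc (2 * i)"] by simp
  then show ?thesis by (simp add: ballot_def)
qed

lemma ballot_0_eq_catalan: "ballot i 0 = catalan i"
proof -
  \<comment> \<open>Absorption expresses the subtracted binomial through the central one, which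
    leaves the factor \<open>1 / (i + 1)\<close>.\<close>
  have "Suc (2 * i) * ((2 * i) choose i) = (((2 * i) choose i) + ((2 * i) choose Suc i)) * Suc i"
    using Suc_times_binomial_eq[of "2 * i" i] by (simp only: binomial_Suc_Suc)
  then have "real (Suc (2 * i) * ((2 * i) choose i)) =
      real ((((2 * i) choose i) + ((2 * i) choose Suc i)) * Suc i)"
    by (rule arg_cong)
  then show ?thesis
    by (simp add: ballot_def catalan_def field_simps)
qed

section \<open>The binomial transform of the ballot numbers\<close>

definition ballot_transform :: "nat \<Rightarrow> nat \<Rightarrow> real" where
  "ballot_transform n k = (\<Sum>i\<le>n. real (n choose i) * ballot i k)"

lemma ballot_transform_Suc:
  "ballot_transform (Suc n) k =
    ballot_transform n k + (\<Sum>i\<le>n. real (n choose i) * ballot (Suc i) k)"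
proof -
  have "ballot_transform (Suc n) k =
      ballot 0 k + (\<Sum>i\<le>n. real ((n choose Suc i) + (n choose i)) * ballot (Suc i) k)"
    unfolding ballot_transform_def by (subst sum.atMost_Suc_shift) (simp add: add.commute)
  also have "\<dots> = ballot 0 k + (\<Sum>i\<le>n. real (n choose Suc i) * ballot (Suc i) k) +
      (\<Sum>i\<le>n. real (n choose i) * ballot (Suc i) k)"
    by (simp add: algebra_simps sum.distrib)
  \<comment> \<open>The term for \<open>i = 0\<close> is absorbed by the index shift; the extra top
    term vanishes because \<open>n choose Suc n\<close> is 0.\<close>
  also have "ballot 0 k + (\<Sum>i\<le>n. real (n choose Suc i) * ballot (Suc i) k) =
      (\<Sum>i\<le>Suc n. real (n choose i) * ballot i k)"
    by (subst sum.atMost_Suc_shift) simp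
  also have "\<dots> = ballot_transform n k"
    by (simp add: ballot_transform_def)
  finally show ?thesis .
qed

lemma ballot_transform_Suc_Suc:
  "ballot_transform (Suc n) (Suc k) = ballot_transform (Suc n) (Suc (Suc k)) +
    ballot_transform n (Suc k) - ballot_transform n (Suc (Suc k)) + ballot_transform n k"
  unfolding ballot_transform_Suc
  by (simp add: ballot_Suc_Suc[of _ k] ballot_transform_def distrib_left sum.distrib)

lemma ballot_transform_Suc_0:
  "ballot_transform (Suc n) 0 =
    ballot_transform (Suc n) 1 + ballot_transform n 0 - ballot_transform n 1"
  unfolding ballot_transform_Suc by (simp add: ballot_Suc_0)

lemma ballot_transform_eq_0: "n < k \<Longrightarrow> ballot_transform n k = 0"
  by (simp add: ballot_transform_def ballot_eq_0)

text \<open>Both sides satisfy the same recurrence and vanish for large \<open>k\<close>, so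
  induction on \<open>n\<close> is combined with downward induction on \<open>k\<close>. The offset
  2 is the least number of extensions.\<close>

lemma num_ext_ge_avoiders:
  "real (num_ext_ge (avoiders (Suc n)) (k + 2)) = ballot_transform n k"
proof (induction n arbitrary: k)
  case 0
  have "{x \<in> avoiders (Suc 0). k + 2 \<le> card (ext x)} = (if k = 0 then {[0]} else {})"
    by (auto simp: avoiders_1 card_ext_singleton)
  then show ?case
    by (auto simp: num_ext_ge_def ballot_transform_def ballot_0_0 ballot_eq_0)
next
  case (Suc n)
  let ?U = "\<lambda>n k. num_ext_ge (avoiders (Suc n)) (k + 2)"
  have ge_rec: "?U m k = num_ext_eq (avoiders (Suc m)) (k + 2) + ?U m (Suc k)" for m k
    using num_ext_ge_rec[of "avoiders (Suc m)" "k + 2"] by simp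
  \<comment> \<open>The recurrence of \<open>ballot_transform_Suc_Suc\<close>, with the negative
    term moved across since these counts are naturals.\<close>
  have rec: "?U (Suc n) (Suc k) + ?U n (Suc (Suc k)) =
      ?U (Suc n) (Suc (Suc k)) + ?U n (Suc k) + ?U n k" for k
    using ge_rec[of "Suc n" "Suc k"] ge_rec[of n "Suc k"] ge_rec[of n k]
      num_ext_eq_avoiders_Suc[of "Suc n" "k + 2"] num_ext_eq_avoiders_pos_Suc_Suc[of n "k + 3"]
    by (simp add: numeral_3_eq_3)
  \<comment> \<open>For exactly two extensions two of the three classes are empty: no avoider has
    just one extension, and a positive last letter behind two zeros gives at least three.\<close>
  have rec0: "?U (Suc n) 0 + ?U n 1 = ?U (Suc n) 1 + ?U n 0"
    using ge_rec[of "Suc n" 0] ge_rec[of n 0] num_ext_eq_avoiders_Suc[of "Suc n" 1]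
      num_ext_eq_avoiders_pos_Suc_Suc[of n 2] num_ext_eq_avoiders_1[of n]
    by (simp add: numeral_2_eq_2)
  have large: "real (?U (Suc n) k) = ballot_transform (Suc n) k" if "k > Suc n" for k
    using that num_ext_ge_eq_0[of "avoiders (Suc (Suc n))" "Suc (Suc n)" "k + 2"]
    by (simp add: ballot_transform_eq_0)
  show ?case
  proof (cases "k \<le> Suc (Suc n)")
    case True
    then show ?thesis
    proof (induction k rule: inc_induct)
      case base
      show ?case by (rule large) simp
    next
      case (step k)
      show ?case
      proof (cases k)
        case 0
        then show ?thesis
          using arg_cong[OF rec0, of real] step.IH Suc.IH[of 0] Suc.IH[of 1] ballot_transform_Suc_0[of n]
          by simp
      next
        case (Suc j)
        then show ?thesis
          using arg_cong[OF rec[of j], of real] step.IH Suc.IH[of j] Suc.IH[of "Suc j"]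
            Suc.IH[of "Suc (Suc j)"] ballot_transform_Suc_Suc[of n j]
          by simp
      qed
    qed
  qed (use large in simp)
qed

theorem theorem4:
  fixes n :: nat
  assumes "n \<ge> 1"
  shows "real (card {x. ascent_sequence x \<and> length x = n \<and> avoids x [0, 0, 2, 1]}) =
         (\<Sum>k = 0..n - 1. real ((n - 1) choose k) * catalan k)"
proof -
  obtain m where n: "n = Suc m"
    using assms by (cases n) auto
  have "{x. ascent_sequence x \<and> length x = n \<and> avoids x [0, 0, 2, 1]} = avoiders (Suc m)"
    by (auto simp: avoiders_def good_def n)
  then have "real (card {x. ascent_sequence x \<and> length x = n \<and> avoids x [0, 0, 2, 1]}) =
      ballot_transform m 0"
    using num_ext_ge_avoiders[of m 0] by (simp only: card_avoiders add_0)
  then show ?thesis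
    by (simp add: n ballot_transform_def ballot_0_eq_catalan atLeast0AtMost)
qed

end
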